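(* Let $G$ be a connected finite simple graph which is not isomorphic to $K_1$, nor to the star $K_{1,i}$ for any $1\leq i\leq 3$. Then $E(G)\geq 4$.
   Context: The energy $E(G)$ of a graph $G$ is the sum of the absolute values of all eigenvalues of its adjacency matrix. $K_{1,i}$ denotes the complete bipartite graph with parts of sizes $1$ and $i$. *)

theory Defs
  imports "Graph_Theory.Kuratowski" "Jordan_Normal_Form.Spectral_Radius"
begin

text \<open>
  A finite simple graph is a \<^locale>\<open>graph\<close>, i.e. a finite, loop-free, symmetric digraph
  without multiple arcs; each undirected edge appears as a pair of opposite arcs.
  \<^const>\<open>Digraph_Component.connected\<close> requires a nonempty vertex set.
\<close>

definition adjacency_matrix :: "('a, 'b) pre_digraph \<Rightarrow> 'a list \<Rightarrow> complex mat" where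
  "adjacency_matrix G vs =
     Matrix.mat (length vs) (length vs) (\<lambda>(i, j). of_bool (vs ! i \<rightarrow>\<^bsub>G\<^esub> vs ! j))"

text \<open>
  Eigenvalues are taken over the complex numbers and counted with algebraic multiplicity, so that
  every matrix has its full number of eigenvalues by construction.
\<close>

definition matrix_energy :: "complex mat \<Rightarrow> real" where
  "matrix_energy A = (\<Sum>k\<in>spectrum A. real (order k (char_poly A)) * cmod k)"

text \<open>The vertex enumeration chosen here is irrelevant, see \<open>graph_energy_eq\<close> below.\<close>

definition graph_energy :: "('a, 'b) pre_digraph \<Rightarrow> real" where
  "graph_energy G = matrix_energy (adjacency_matrix G (SOME vs. distinct vs \<and> set vs = verts G))"

lemma adjacency_matrix_carrier [simp]:
  "adjacency_matrix G vs \<in> carrier_mat (length vs) (length vs)"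
  by (simp add: adjacency_matrix_def)

lemma similar_adjacency_matrix:
  assumes "distinct vs" "distinct ws" "set vs = set ws"
  shows "similar_mat (adjacency_matrix G vs) (adjacency_matrix G ws)"
proof -
  define n where "n = length vs"
  have n: "length vs = n" "length ws = n"
    using assms distinct_card[of vs] distinct_card[of ws] by (simp_all add: n_def)
  define P :: "complex mat" where "P = Matrix.mat n n (\<lambda>(i, j). of_bool (vs ! i = ws ! j))"
  define Q :: "complex mat" where "Q = Matrix.mat n n (\<lambda>(i, j). of_bool (ws ! i = vs ! j))"
  have pick: "(\<Sum>k\<in>{0..<n}. of_bool (xs ! k = x) * f (xs ! k)) = f x"
    if "distinct xs" "length xs = n" "x \<in> set xs" for xs x and f :: "'a \<Rightarrow> complex"
  proof -
    have "(\<Sum>k\<in>{0..<n}. of_bool (xs ! k = x) * f (xs ! k)) = (\<Sum>y\<in>set xs. of_bool (y = x) * f y)"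
      using that by (intro sum.reindex_bij_betw bij_betw_nth) auto
    also have "\<dots> = (\<Sum>y\<in>set xs. if y = x then f y else 0)"
      by (intro sum.cong) auto
    finally show ?thesis using that by simp
  qed
  have mem: "vs ! i \<in> set ws" "ws ! i \<in> set vs" "vs ! i \<in> set vs" "ws ! i \<in> set ws" if "i < n" for i
    using that n assms(3) nth_mem[of i vs] nth_mem[of i ws] by simp_all
  have PQ: "P * Q = 1\<^sub>m n"
  proof (rule eq_matI)
    fix i j assume "i < dim_row (1\<^sub>m n :: complex mat)" "j < dim_col (1\<^sub>m n :: complex mat)"
    hence ij: "i < n" "j < n" by simp_all
    have "(P * Q) $$ (i, j) = (\<Sum>k\<in>{0..<n}. of_bool (ws ! k = vs ! i) * of_bool (ws ! k = vs ! j))"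
      using ij by (simp add: P_def Q_def scalar_prod_def eq_commute[of "vs ! i"])
    also have "\<dots> = of_bool (vs ! i = vs ! j)"
      using pick[of ws "vs ! i" "\<lambda>y. of_bool (y = vs ! j)"] assms n mem ij by simp
    finally show "(P * Q) $$ (i, j) = 1\<^sub>m n $$ (i, j)"
      using ij assms n by (simp add: nth_eq_iff_index_eq)
  qed (simp_all add: P_def Q_def)
  have QP: "Q * P = 1\<^sub>m n"
    by (rule mat_mult_left_right_inverse[OF _ _ PQ]) (simp_all add: P_def Q_def)
  have PB: "P * adjacency_matrix G ws = adjacency_matrix G vs * P"
  proof (rule eq_matI)
    fix i j
    assume "i < dim_row (adjacency_matrix G vs * P)" "j < dim_col (adjacency_matrix G vs * P)"
    hence ij: "i < n" "j < n" by (simp_all add: P_def adjacency_matrix_def n)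
    have "(P * adjacency_matrix G ws) $$ (i, j) =
        (\<Sum>k\<in>{0..<n}. of_bool (ws ! k = vs ! i) * of_bool ((ws ! k, ws ! j) \<in> arcs_ends G))"
      using ij n by (simp add: P_def adjacency_matrix_def scalar_prod_def eq_commute[of "vs ! i"])
    also have "\<dots> = of_bool ((vs ! i, ws ! j) \<in> arcs_ends G)"
      using pick[of ws "vs ! i" "\<lambda>y. of_bool ((y, ws ! j) \<in> arcs_ends G)"] assms n mem ij by simp
    also have "\<dots> = (\<Sum>k\<in>{0..<n}. of_bool (vs ! k = ws ! j) * of_bool ((vs ! i, vs ! k) \<in> arcs_ends G))"
      using pick[of vs "ws ! j" "\<lambda>y. of_bool ((vs ! i, y) \<in> arcs_ends G)"] assms n mem ij by simp
    also have "\<dots> = (adjacency_matrix G vs * P) $$ (i, j)"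
      using ij n by (simp add: P_def adjacency_matrix_def scalar_prod_def mult.commute)
    finally show "(P * adjacency_matrix G ws) $$ (i, j) = (adjacency_matrix G vs * P) $$ (i, j)" .
  qed (simp_all add: P_def adjacency_matrix_def n)
  have carr: "P \<in> carrier_mat n n" "Q \<in> carrier_mat n n"
    "adjacency_matrix G vs \<in> carrier_mat n n" "adjacency_matrix G ws \<in> carrier_mat n n"
    using n by (simp_all add: P_def Q_def adjacency_matrix_def)
  have "P * adjacency_matrix G ws * Q = adjacency_matrix G vs * (P * Q)"
    unfolding PB using carr by (simp add: assoc_mult_mat[of _ n n _ n _ n])
  hence "adjacency_matrix G vs = P * adjacency_matrix G ws * Q"
    using carr by (simp add: PQ)
  with PQ QP carr show ?thesis
    by (intro similar_matI[of _ _ P Q n]) auto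
qed

lemma graph_energy_eq:
  assumes "distinct vs" "set vs = verts G"
  shows "graph_energy G = matrix_energy (adjacency_matrix G vs)"
proof -
  define ws where "ws = (SOME ws. distinct ws \<and> set ws = verts G)"
  have "distinct ws \<and> set ws = verts G"
    unfolding ws_def by (rule someI[of _ vs]) (use assms in simp)
  hence "similar_mat (adjacency_matrix G ws) (adjacency_matrix G vs)"
    using assms by (intro similar_adjacency_matrix) auto
  hence "char_poly (adjacency_matrix G ws) = char_poly (adjacency_matrix G vs)"
    by (rule char_poly_similar)
  thus ?thesis
    unfolding graph_energy_def ws_def[symmetric] matrix_energy_def
    by (simp add: spectrum_root_char_poly[OF adjacency_matrix_carrier])
qed

end

theory Submission
  imports Defs
begin

text \<open>
  Let \<open>\<lambda>\<^sub>1, \<dots>, \<lambda>\<^sub>n\<close> be the eigenvalues and \<open>m\<close> the number of edges. The trace of the adjacency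
  matrix is \<open>0\<close> and that of its square is \<open>2 m\<close>, so \<open>\<Sum>\<^sub>i \<lambda>\<^sub>i\<^sup>2 = 2 m\<close> and
  \<open>\<Sum>\<^sub>i\<^sub>\<noteq>\<^sub>j \<lambda>\<^sub>i \<lambda>\<^sub>j = - 2 m\<close>. Bounding the two parts of \<open>(\<Sum>\<^sub>i \<bar>\<lambda>\<^sub>i\<bar>)\<^sup>2\<close> from below by the
  triangle inequality gives \<open>E\<^sup>2 \<ge> 4 m\<close>, which settles \<open>m \<ge> 4\<close>. A connected graph with at most three
  edges is a star, a triangle or a path on four vertices. The triangle has the eigenvalue \<open>2\<close>, and
  \<open>E \<ge> 2 \<bar>\<lambda>\<bar>\<close> for every eigenvalue because their sum vanishes; the path has the eigenvalues
  \<open>(\<plusminus>1 \<plusminus> sqrt 5) / 2\<close>, with energy \<open>2 sqrt 5\<close>.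
\<close>

section \<open>Energy and eigenvalue lists\<close>

lemma order_prod_linear_factors:
  "order k (\<Prod>a\<leftarrow>as. [:- a, 1:]) = count_list as (k :: complex)"
proof -
  have "order k (\<Prod>a\<leftarrow>as. [:- a, 1:]) = (\<Sum>a\<leftarrow>as. if k = a then 1 else 0)"
    by (subst order_prod_list) (auto simp: o_def order_linear' equation_minus_iff)
  also have "\<dots> = count_list as k"
    by (induction as) auto
  finally show ?thesis .
qed

text \<open>Multiplicities become repetitions in a list, a form that suits induction and the
  triangle inequality.\<close>

lemma matrix_energy_eq_sum_list:
  assumes A: "A \<in> carrier_mat n n" and as: "char_poly A = (\<Prod>a\<leftarrow>as. [:- a, 1:])"
  shows "spectrum A = set as" "matrix_energy A = (\<Sum>a\<leftarrow>as. cmod a)"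
proof -
  show sp: "spectrum A = set as"
    using as by (auto simp: spectrum_root_char_poly[OF A] poly_prod_list prod_list_zero_iff)
  \<comment> \<open>The index set \<open>K\<close> stays fixed while the list shrinks in the
    induction.\<close>
  have "(\<Sum>k\<in>K. real (count_list bs k) * cmod k) = (\<Sum>b\<leftarrow>bs. cmod b)"
    if "finite K" "set bs \<subseteq> K" for K bs
    using that(2)
  proof (induction bs)
    case (Cons b bs)
    have "(\<Sum>k\<in>K. real (count_list (b # bs) k) * cmod k) =
        (\<Sum>k\<in>K. real (count_list bs k) * cmod k + (if k = b then cmod k else 0))"
      by (intro sum.cong) (auto simp: algebra_simps)
    thus ?case
      using Cons that(1) by (simp add: sum.distrib)
  qed simp
  thus "matrix_energy A = (\<Sum>a\<leftarrow>as. cmod a)"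
    by (simp add: matrix_energy_def sp as order_prod_linear_factors)
qed

section \<open>Traces of a matrix and of its square\<close>

definition mat_trace :: "'a :: comm_ring_1 mat \<Rightarrow> 'a" where
  "mat_trace A = (\<Sum>i<dim_row A. A $$ (i, i))"

lemma mat_trace_mult:
  assumes "A \<in> carrier_mat n n" "B \<in> carrier_mat n n"
  shows "mat_trace (A * B) = (\<Sum>i<n. \<Sum>j<n. A $$ (i, j) * B $$ (j, i))"
  using assms by (simp add: mat_trace_def scalar_prod_def atLeast0LessThan)

lemma mat_trace_comm:
  assumes "A \<in> carrier_mat n n" "B \<in> carrier_mat n n"
  shows "mat_trace (A * B) = mat_trace (B * A)"
  unfolding mat_trace_mult[OF assms] mat_trace_mult[OF assms(2,1)]
  by (subst sum.swap) (simp add: mult.commute)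

lemma mat_trace_similar:
  assumes "similar_mat A B"
  shows "mat_trace A = mat_trace B"
proof -
  obtain P Q where w: "similar_mat_wit A B P Q"
    using assms by (auto simp: similar_mat_def)
  define n where "n = dim_row A"
  note d = similar_mat_witD[OF n_def w]
  have "mat_trace A = mat_trace ((P * B) * Q)"
    using d by simp
  also have "\<dots> = mat_trace (Q * (P * B))"
    using d by (intro mat_trace_comm[of _ n]) auto
  also have "Q * (P * B) = Q * P * B"
    using d by (intro assoc_mult_mat[symmetric, of _ n n _ n _ n]) auto
  finally show ?thesis
    using d by simp
qed

text \<open>Schur decomposition makes \<open>A\<close> similar to an upper triangular
  \<open>B\<close> with diagonal \<open>as\<close>; the same witnesses make \<open>A * A\<close>
  similar to \<open>B * B\<close>, and similar matrices have equal trace.\<close>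

lemma
  assumes A: "A \<in> carrier_mat n n" and as: "char_poly A = (\<Prod>a\<leftarrow>as. [:- a, 1:])"
  shows mat_trace_eq_sum_eigenvalues: "mat_trace A = sum_list (as :: complex list)"
    and mat_trace_square_eq_sum_eigenvalues: "mat_trace (A * A) = (\<Sum>a\<leftarrow>as. a\<^sup>2)"
proof -
  obtain B P Q where s: "schur_decomposition A as = (B, P, Q)"
    by (cases "schur_decomposition A as")
  note sd = schur_decomposition[OF A as s]
  have sim: "similar_mat A B"
    using sd by (auto simp: similar_mat_def)
  have B: "B \<in> carrier_mat n n"
    using sd similar_mat_witD2[OF A] by blast
  have ut: "B $$ (i, j) = 0" if "j < i" "i < n" for i j
    using sd that B by auto
  have as_eq: "as = map (\<lambda>i. B $$ (i, i)) [0..<n]"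
    using sd B by (auto simp: diag_mat_def)
  have "mat_trace A = mat_trace B"
    by (rule mat_trace_similar[OF sim])
  thus "mat_trace A = sum_list as"
    using B by (simp add: mat_trace_def as_eq interv_sum_list_conv_sum_set_nat atLeast0LessThan)
  have "similar_mat (A * A) (B * B)"
    using similar_mat_wit_pow[of A B P Q 2] sd A B
    by (auto simp: similar_mat_def numeral_2_eq_2)
  hence "mat_trace (A * A) = (\<Sum>i<n. \<Sum>j<n. B $$ (i, j) * B $$ (j, i))"
    by (simp add: mat_trace_similar mat_trace_mult[OF B B])
  \<comment> \<open>For distinct \<open>i\<close> and \<open>j\<close>, one of the two factors lies
    below the diagonal of \<open>B\<close> and vanishes.\<close>
  also have "\<dots> = (\<Sum>i<n. \<Sum>j<n. if j = i then (B $$ (i, i))\<^sup>2 else 0)"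
  proof (intro sum.cong refl)
    fix i j assume "i \<in> {..<n}" "j \<in> {..<n}"
    thus "B $$ (i, j) * B $$ (j, i) = (if j = i then (B $$ (i, i))\<^sup>2 else 0)"
      using ut[of i j] ut[of j i] by (cases i j rule: linorder_cases) (auto simp: power2_eq_square)
  qed
  also have "\<dots> = (\<Sum>a\<leftarrow>as. a\<^sup>2)"
    by (simp add: as_eq o_def interv_sum_list_conv_sum_set_nat atLeast0LessThan)
  finally show "mat_trace (A * A) = (\<Sum>a\<leftarrow>as. a\<^sup>2)" .
qed

section \<open>Lower bounds for the energy\<close>

lemma norm_sum_list_le:
  fixes as :: "complex list"
  shows "cmod (sum_list as) \<le> (\<Sum>a\<leftarrow>as. cmod a)"
  by (induction as) (auto intro: norm_triangle_le)

text \<open>The first difference is the sum of the products of entries at distinct positions, the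
  second term the sum of the squares; the triangle inequality bounds them by the off-diagonal and
  diagonal parts of the expanded right-hand side.\<close>

lemma norm_square_sum_list_le:
  fixes as :: "complex list"
  shows "cmod ((sum_list as)\<^sup>2 - (\<Sum>a\<leftarrow>as. a\<^sup>2)) + cmod (\<Sum>a\<leftarrow>as. a\<^sup>2) \<le> (\<Sum>a\<leftarrow>as. cmod a)\<^sup>2"
proof -
  define q :: "complex list \<Rightarrow> real" where "q = (\<lambda>as. \<Sum>a\<leftarrow>as. (cmod a)\<^sup>2)"
  have "cmod ((sum_list as)\<^sup>2 - (\<Sum>a\<leftarrow>as. a\<^sup>2)) + q as \<le> (\<Sum>a\<leftarrow>as. cmod a)\<^sup>2"
  proof (induction as)
    case (Cons a as)
    define S T where "S = sum_list as" and "T = (\<Sum>a\<leftarrow>as. a\<^sup>2)"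
    have eq: "(a + S)\<^sup>2 - (a\<^sup>2 + T) = (S\<^sup>2 - T) + 2 * a * S"
      by (simp add: power2_eq_square algebra_simps)
    have "cmod ((a + S)\<^sup>2 - (a\<^sup>2 + T)) \<le> cmod (S\<^sup>2 - T) + 2 * cmod a * cmod S"
      unfolding eq using norm_triangle_ineq[of "S\<^sup>2 - T" "2 * a * S"] by (simp add: norm_mult)
    also have "\<dots> \<le> cmod (S\<^sup>2 - T) + 2 * cmod a * (\<Sum>a\<leftarrow>as. cmod a)"
      using norm_sum_list_le[of as] by (intro add_left_mono mult_left_mono) (auto simp: S_def)
    finally show ?case
      using Cons by (simp add: S_def T_def q_def power2_sum)
  qed (simp add: q_def)
  moreover have "cmod (\<Sum>a\<leftarrow>as. a\<^sup>2) \<le> q as"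
    using norm_sum_list_le[of "map (\<lambda>a. a\<^sup>2) as"] by (simp add: q_def o_def norm_power)
  ultimately show ?thesis
    by linarith
qed

text \<open>As the eigenvalues sum to zero, the diagonal and off-diagonal parts of the squared sum
  are opposite, so both have modulus \<open>cmod (mat_trace (A * A))\<close>.\<close>

lemma matrix_energy_square_ge:
  assumes A: "A \<in> carrier_mat n n" and tr: "mat_trace A = 0"
  shows "2 * cmod (mat_trace (A * A)) \<le> (matrix_energy A)\<^sup>2"
proof -
  obtain as where as: "char_poly A = (\<Prod>a\<leftarrow>as. [:- a, 1:])"
    using char_poly_factorized[OF A] by blast
  show ?thesis
    using norm_square_sum_list_le[of as] tr
    by (simp add: matrix_energy_eq_sum_list[OF A as] mat_trace_eq_sum_eigenvalues[OF A as]
        mat_trace_square_eq_sum_eigenvalues[OF A as])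
qed

text \<open>One copy of \<open>k\<close> is minus the sum of all other eigenvalues, so these
  contribute at least \<open>cmod k\<close> again.\<close>

lemma matrix_energy_ge_double_eigenvalue:
  assumes A: "A \<in> carrier_mat n n" and tr: "mat_trace A = 0" and k: "eigenvalue A k"
  shows "2 * cmod k \<le> matrix_energy A"
proof -
  obtain as where as: "char_poly A = (\<Prod>a\<leftarrow>as. [:- a, 1:])"
    using char_poly_factorized[OF A] by blast
  have "k \<in> set as"
    using k matrix_energy_eq_sum_list(1)[OF A as] by (auto simp: spectrum_def)
  then obtain bs cs where split: "as = bs @ k # cs"
    by (meson split_list)
  have "sum_list bs + (k + sum_list cs) = 0"
    using tr by (simp add: mat_trace_eq_sum_eigenvalues[OF A as] split)
  hence "k = - sum_list (bs @ cs)"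
    by (simp add: eq_neg_iff_add_eq_0 algebra_simps)
  hence "cmod k = cmod (sum_list (bs @ cs))"
    by (metis norm_minus_cancel)
  also have "\<dots> \<le> (\<Sum>a\<leftarrow>bs @ cs. cmod a)"
    by (rule norm_sum_list_le)
  finally show ?thesis
    by (simp add: matrix_energy_eq_sum_list[OF A as] split)
qed

text \<open>Each eigenvalue has multiplicity at least one, so exhibiting some distinct eigenvalues
  already bounds the energy, without computing the characteristic polynomial.\<close>

lemma matrix_energy_ge_sum_eigenvalues:
  assumes A: "A \<in> carrier_mat n n" and S: "\<And>k. k \<in> S \<Longrightarrow> eigenvalue A k"
  shows "(\<Sum>k\<in>S. cmod k) \<le> matrix_energy A"
proof -
  have nz: "char_poly A \<noteq> 0"
    using degree_monic_char_poly[OF A] by auto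
  have "(\<Sum>k\<in>S. cmod k) \<le> (\<Sum>k\<in>spectrum A. cmod k)"
    using S card_finite_spectrum[OF A] by (intro sum_mono2) (auto simp: spectrum_def)
  also have "\<dots> \<le> matrix_energy A"
    unfolding matrix_energy_def
  proof (rule sum_mono)
    fix k assume "k \<in> spectrum A"
    hence "order k (char_poly A) \<noteq> 0"
      using nz by (simp add: spectrum_root_char_poly[OF A] order_root)
    thus "cmod k \<le> real (order k (char_poly A)) * cmod k"
      using mult_right_mono[of 1 "real (order k (char_poly A))" "cmod k"] by simp
  qed
  finally show ?thesis .
qed

section \<open>Energy of graphs\<close>

lemma sum_nth_distinct:
  assumes "distinct vs"
  shows "(\<Sum>i<length vs. f (vs ! i)) = sum f (set vs)"
  using assms by (intro sum.reindex_bij_betw bij_betw_nth) auto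

lemma mat_trace_adjacency_matrix:
  assumes "loopfree_digraph G"
  shows "mat_trace (adjacency_matrix G vs) = 0"
proof -
  interpret loopfree_digraph G by fact
  show ?thesis
    by (auto simp: mat_trace_def adjacency_matrix_def intro!: sum.neutral dest: adj_not_same)
qed

text \<open>The trace counts closed walks of length two; by symmetry each is given by its first
  arc.\<close>

lemma mat_trace_square_adjacency_matrix:
  assumes G: "graph G" and vs: "distinct vs" "set vs = verts G"
  shows "mat_trace (adjacency_matrix G vs * adjacency_matrix G vs) = of_nat (card (arcs_ends G))"
proof -
  interpret graph G by fact
  have sub: "arcs_ends G \<subseteq> verts G \<times> verts G"
    by (auto dest: adj_in_verts)
  have "mat_trace (adjacency_matrix G vs * adjacency_matrix G vs) =
      (\<Sum>i<length vs. \<Sum>j<length vs. of_bool ((vs ! i, vs ! j) \<in> arcs_ends G))"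
    unfolding mat_trace_mult[OF adjacency_matrix_carrier adjacency_matrix_carrier]
    by (intro sum.cong refl) (auto simp: adjacency_matrix_def dest: arcs_ends_symmetric[OF sym_arcs])
  also have "\<dots> = (\<Sum>u\<in>verts G. \<Sum>v\<in>verts G. of_bool ((u, v) \<in> arcs_ends G))"
    by (simp add: sum_nth_distinct[OF vs(1), where f = "\<lambda>v. of_bool ((u, v) \<in> arcs_ends G)" for u]
        sum_nth_distinct[OF vs(1), where f = "\<lambda>u. \<Sum>v\<in>verts G. of_bool ((u, v) \<in> arcs_ends G)"] vs(2)
        del: sum_of_bool_eq)
  also have "\<dots> = (\<Sum>e\<in>verts G \<times> verts G. of_bool (e \<in> arcs_ends G))"
    by (simp add: sum.cartesian_product split_def del: sum_of_bool_eq)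
  also have "\<dots> = of_nat (card (arcs_ends G))"
    using sub by (simp add: sum_of_bool_eq inf.absorb2)
  finally show ?thesis .
qed

text \<open>Eigenvectors as functions on vertices, independent of the enumeration
  \<open>vs\<close>.\<close>

lemma eigenvalue_adjacency_matrixI:
  assumes vs: "distinct vs" "set vs = verts G"
    and f: "\<And>u. u \<in> verts G \<Longrightarrow> (\<Sum>v\<in>verts G. of_bool (u \<rightarrow>\<^bsub>G\<^esub> v) * f v) = k * f u"
    and nz: "u \<in> verts G" "f u \<noteq> 0"
  shows "eigenvalue (adjacency_matrix G vs) k"
proof -
  define n where "n = length vs"
  define x where "x = Matrix.vec n (\<lambda>i. f (vs ! i))"
  obtain i where i: "i < n" "vs ! i = u"
    using nz(1) vs(2) by (metis in_set_conv_nth n_def)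
  have "x \<noteq> 0\<^sub>v n"
  proof
    assume "x = 0\<^sub>v n"
    hence "x $ i = 0"
      using i by simp
    thus False
      using i nz by (simp add: x_def)
  qed
  moreover have "adjacency_matrix G vs *\<^sub>v x = k \<cdot>\<^sub>v x"
  proof (rule eq_vecI)
    fix i assume "i < dim_vec (k \<cdot>\<^sub>v x)"
    hence i: "i < n"
      by (simp add: x_def)
    have "(adjacency_matrix G vs *\<^sub>v x) $ i =
        (\<Sum>j<n. of_bool (vs ! i \<rightarrow>\<^bsub>G\<^esub> vs ! j) * f (vs ! j))"
      using i by (simp add: adjacency_matrix_def x_def scalar_prod_def atLeast0LessThan n_def)
    also have "\<dots> = (\<Sum>v\<in>verts G. of_bool (vs ! i \<rightarrow>\<^bsub>G\<^esub> v) * f v)"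
      unfolding n_def vs(2)[symmetric] by (rule sum_nth_distinct[OF vs(1)])
    also have "\<dots> = k * f (vs ! i)"
      using nth_mem[of i vs] i vs(2) by (simp add: f n_def)
    finally show "(adjacency_matrix G vs *\<^sub>v x) $ i = (k \<cdot>\<^sub>v x) $ i"
      using i by (simp add: x_def)
  qed (simp add: x_def adjacency_matrix_def n_def)
  ultimately have "eigenvector (adjacency_matrix G vs) x k"
    by (simp add: eigenvector_def x_def adjacency_matrix_def n_def)
  thus ?thesis
    by (auto simp: eigenvalue_def)
qed

text \<open>\<open>arcs_ends G\<close> holds both orientations of each edge, so this is the bound by
  four times the number of edges.\<close>

lemma graph_energy_square_ge:
  assumes G: "graph G"
  shows "2 * real (card (arcs_ends G)) \<le> (graph_energy G)\<^sup>2"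
proof -
  interpret graph G by fact
  obtain vs where vs: "distinct vs" "set vs = verts G"
    using finite_distinct_list[OF finite_verts] by blast
  show ?thesis
    using matrix_energy_square_ge[OF adjacency_matrix_carrier mat_trace_adjacency_matrix[of G vs]]
      loopfree_digraph_axioms
    by (simp add: graph_energy_eq[OF vs] mat_trace_square_adjacency_matrix[OF G vs])
qed

section \<open>The triangle and the path on four vertices\<close>

lemma graph_energy_triangle:
  assumes G: "graph G" and V: "verts G = {a, b, c}" and dist: "a \<noteq> b" "b \<noteq> c" "a \<noteq> c"
    and E: "arcs_ends G = {(a, b), (b, a), (b, c), (c, b), (a, c), (c, a)}"
  shows "4 \<le> graph_energy G"
proof -
  interpret graph G by fact
  obtain vs where vs: "distinct vs" "set vs = verts G"
    using finite_distinct_list[OF finite_verts] by blast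
  \<comment> \<open>The triangle is 2-regular, so constant functions are eigenvectors for 2.\<close>
  have "eigenvalue (adjacency_matrix G vs) 2"
    by (rule eigenvalue_adjacency_matrixI[OF vs, where u = a and f = "\<lambda>_. 1"])
      (use dist in \<open>auto simp: V E\<close>)
  from matrix_energy_ge_double_eigenvalue[OF adjacency_matrix_carrier _ this]
  show ?thesis
    using mat_trace_adjacency_matrix[OF loopfree_digraph_axioms] by (simp add: graph_energy_eq[OF vs])
qed

lemma graph_energy_path4:
  assumes G: "graph G" and V: "verts G = {a, b, c, d}" and dist: "distinct [a, b, c, d]"
    and E: "arcs_ends G = {(a, b), (b, a), (b, c), (c, b), (c, d), (d, c)}"
  shows "4 \<le> graph_energy G"
proof -
  interpret graph G by fact
  obtain vs where vs: "distinct vs" "set vs = verts G"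
    using finite_distinct_list[OF finite_verts] by blast
  have ev: "eigenvalue (adjacency_matrix G vs) k" if k: "k ^ 4 - 3 * k\<^sup>2 + 1 = 0" for k
  proof -
    \<comment> \<open>Solving the eigenvector equations from one end of the path to the other leaves the
        characteristic equation as the last one.\<close>
    define f where "f = (\<lambda>_. 0)(a := 1, b := k, c := k\<^sup>2 - 1, d := k ^ 3 - 2 * k)"
    have f: "f a = 1" "f b = k" "f c = k\<^sup>2 - 1" "f d = k ^ 3 - 2 * k"
      using dist by (auto simp: f_def)
    have "k * (k ^ 3 - 2 * k) = k\<^sup>2 - 1"
      using k by (simp add: algebra_simps power2_eq_square power3_eq_cube power4_eq_xxxx)
    hence "(\<Sum>v\<in>verts G. of_bool (u \<rightarrow>\<^bsub>G\<^esub> v) * f v) = k * f u" if "u \<in> verts G" for u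
      using that dist
      by (auto simp: V E f algebra_simps power2_eq_square power3_eq_cube)
    thus ?thesis
      by (rule eigenvalue_adjacency_matrixI[OF vs, where u = a]) (simp_all add: V f)
  qed
  \<comment> \<open>The golden ratio and its inverse: their squares are the roots of
    \<open>t\<^sup>2 - 3 * t + 1\<close>.\<close>
  define p q where "p = (1 + sqrt 5) / 2" and "q = (sqrt 5 - 1) / 2"
  \<comment> \<open>The strict inequalities make \<open>p\<close>, \<open>- p\<close>,
    \<open>q\<close>, \<open>- q\<close> four distinct values; \<open>p + q\<close> is
    \<open>sqrt 5\<close>.\<close>
  have pos: "q > 0" "q < p" "2 \<le> p + q"
    using real_le_rsqrt[of 2 5] by (auto simp: p_def q_def field_simps)
  have p2: "p\<^sup>2 = p + 1" and q2: "q\<^sup>2 = 1 - q"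
    by (simp_all add: p_def q_def power2_eq_square field_simps)
  have root: "x ^ 4 - 3 * x\<^sup>2 + 1 = 0" if "x\<^sup>2 = p\<^sup>2 \<or> x\<^sup>2 = q\<^sup>2" for x
  proof -
    have "(p + 1)\<^sup>2 - 3 * (p + 1) + 1 = 0" "(1 - q)\<^sup>2 - 3 * (1 - q) + 1 = 0"
      using p2 q2 by (simp_all add: power2_sum power2_diff)
    hence "(x\<^sup>2)\<^sup>2 - 3 * x\<^sup>2 + 1 = 0"
      using that unfolding p2 q2 by metis
    thus ?thesis
      by simp
  qed
  have "eigenvalue (adjacency_matrix G vs) (of_real x)" if "x \<in> {p, - p, q, - q}" for x
  proof (rule ev)
    have "x\<^sup>2 = p\<^sup>2 \<or> x\<^sup>2 = q\<^sup>2"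
      using that by auto
    hence "complex_of_real (x ^ 4 - 3 * x\<^sup>2 + 1) = 0"
      by (simp only: root of_real_0)
    thus "complex_of_real x ^ 4 - 3 * (complex_of_real x)\<^sup>2 + 1 = 0"
      by simp
  qed
  hence "(\<Sum>k\<in>complex_of_real ` {p, - p, q, - q}. cmod k) \<le> matrix_energy (adjacency_matrix G vs)"
    by (intro matrix_energy_ge_sum_eigenvalues[OF adjacency_matrix_carrier]) blast
  moreover have "(\<Sum>k\<in>complex_of_real ` {p, - p, q, - q}. cmod k) = (\<Sum>x\<in>{p, - p, q, - q}. \<bar>x\<bar>)"
    by (subst sum.reindex) (auto simp: inj_on_def)
  moreover have "(\<Sum>x\<in>{p, - p, q, - q}. \<bar>x\<bar>) = 2 * (p + q)"
    using pos by simp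
  ultimately show ?thesis
    using pos by (simp add: graph_energy_eq[OF vs])
qed

section \<open>Connected graphs with at most three edges\<close>

text \<open>A walk from \<open>a\<close> to \<open>b\<close> starts inside \<open>S\<close> and ends
  outside, so some arc of it leaves \<open>S\<close>.\<close>

lemma connected_edge_leaving:
  assumes "graph G" "Digraph_Component.connected G" "a \<in> S" "a \<in> verts G" "b \<in> verts G - S"
  obtains u v where "u \<in> S" "v \<notin> S" "u \<rightarrow>\<^bsub>G\<^esub> v"
proof -
  interpret graph G by fact
  have "a \<rightarrow>\<^sup>*\<^bsub>mk_symmetric G\<^esub> b"
    using assms by (auto simp: connected_def)
  hence "(a, b) \<in> rtrancl_on (verts G) (arcs_ends G)"
    using reachable_mk_symmetric_eq[OF sym_arcs] by (simp add: reachable_def)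
  hence "b \<in> S \<or> (\<exists>u v. u \<in> S \<and> v \<notin> S \<and> u \<rightarrow>\<^bsub>G\<^esub> v)"
    by (induction rule: rtrancl_on_induct) (use assms(3) in auto)
  thus ?thesis
    using assms that by auto
qed

text \<open>A pair of \<open>E\<close> outside \<open>X\<close> brings its reverse, a different pair
  also outside \<open>X\<close>, so \<open>E\<close> would have at least two more elements.\<close>

lemma sym_eq_subset_card:
  assumes "finite E" "sym E" "\<And>x. (x, x) \<notin> E" "X \<subseteq> E" "sym X" "card E < card X + 2"
  shows "E = X"
proof (rule ccontr)
  assume "E \<noteq> X"
  then obtain u v where uv: "(u, v) \<in> E" "(u, v) \<notin> X"
    using assms(4) by auto
  hence vu: "(v, u) \<in> E" "(v, u) \<notin> X" "u \<noteq> v"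
    using assms by (auto dest: symD)
  have "finite X"
    using assms finite_subset by blast
  hence "card (insert (u, v) (insert (v, u) X)) = card X + 2"
    using uv vu by simp
  moreover have "card (insert (u, v) (insert (v, u) X)) \<le> card E"
    using assms uv vu by (intro card_mono) auto
  ultimately show False
    using assms(6) by simp
qed

theorem theorem3:
  fixes G :: "('a, 'b) pre_digraph"
  assumes "graph G"
    and "Digraph_Component.connected G"
    and "\<not> complete_digraph 1 G"
    and "\<And>i. 1 \<le> i \<Longrightarrow> i \<le> 3 \<Longrightarrow> \<not> complete_bipartite_digraph 1 i G"
  shows "graph_energy G \<ge> 4"
proof (cases "card (arcs_ends G) < 8")
  \<comment> \<open>Four edges give eight ordered pairs, and \<open>2 * 8\<close> is the square of
    4.\<close>
  case False
  have "4\<^sup>2 \<le> (graph_energy G)\<^sup>2"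
    using graph_energy_square_ge[OF assms(1)] False by simp
  moreover have "0 \<le> graph_energy G"
    unfolding graph_energy_def matrix_energy_def by (intro sum_nonneg) auto
  ultimately show ?thesis
    by (rule power2_le_imp_le)
next
  case True
  interpret graph G by fact
  define E where "E = arcs_ends G"
  have sym: "(v, u) \<in> E" if "(u, v) \<in> E" for u v
    using that arcs_ends_symmetric[OF sym_arcs] by (auto simp: E_def)
  have irr: "(u, u) \<notin> E" for u
    using adj_not_same by (auto simp: E_def)
  have Ev: "u \<in> verts G" "v \<in> verts G" if "(u, v) \<in> E" for u v
    using that adj_in_verts by (auto simp: E_def)
  have leave: "\<exists>u v. u \<in> S \<and> v \<notin> S \<and> (u, v) \<in> E"
    if "a \<in> S" "a \<in> verts G" "b \<in> verts G" "b \<notin> S" for a b S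
    using connected_edge_leaving[OF assms(1,2) that(1,2), of b] that(3,4)
    unfolding E_def by blast
  have cardE: "card E < 8"
    using True by (simp add: E_def)
  have finE: "finite E"
    by (simp add: E_def arcs_ends_conv)
  have symE: "Relation.sym E"
    using sym by (rule symI)
  \<comment> \<open>Once three edges are exhibited, they are all the edges.\<close>
  have E_eq: "E = X" if "X \<subseteq> E" "Relation.sym X" "card X = 6" for X
    using sym_eq_subset_card[OF finE symE irr that(1,2)] that(3) cardE by simp
  \<comment> \<open>If every edge met \<open>x\<close>, connectedness would join all other vertices
    to \<open>x\<close>, making \<open>G\<close> a single vertex or a star, with at most three
    leaves because \<open>card E < 8\<close>.\<close>
  have no_star: "\<exists>u v. (u, v) \<in> E \<and> u \<noteq> x \<and> v \<noteq> x" if x: "x \<in> verts G" for x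
  proof (rule ccontr)
    assume "\<nexists>u v. (u, v) \<in> E \<and> u \<noteq> x \<and> v \<noteq> x"
    hence star: "u = x \<or> v = x" if "(u, v) \<in> E" for u v
      using that by blast
    define W where "W = verts G - {x}"
    have xW: "(x, w) \<in> E" if w: "w \<in> W" for w
    proof -
      obtain v where "(w, v) \<in> E"
        using leave[of w "{w}" x] w x by (auto simp: W_def)
      moreover from this have "v = x"
        using star w by (auto simp: W_def)
      ultimately show ?thesis
        using sym by simp
    qed
    have E: "E = {x} \<times> W \<union> W \<times> {x}"
    proof (intro equalityI subrelI)
      fix u v assume uv: "(u, v) \<in> E"
      moreover have "u \<noteq> v"
        using uv irr by blast
      ultimately show "(u, v) \<in> {x} \<times> W \<union> W \<times> {x}"
        using star[OF uv] Ev[OF uv] by (auto simp: W_def)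
    next
      fix u v assume "(u, v) \<in> {x} \<times> W \<union> W \<times> {x}"
      thus "(u, v) \<in> E"
        using xW sym by blast
    qed
    have finW: "finite W"
      by (simp add: W_def)
    have "card E = card W + card W"
      unfolding E using finW by (subst card_Un_disjoint) (auto simp: W_def card_cartesian_product)
    hence le: "card W \<le> 3"
      using cardE by simp
    have V: "verts G = {x} \<union> W"
      using x by (auto simp: W_def)
    show False
    proof (cases "W = {}")
      case True
      hence "complete_digraph 1 G"
        using E V assms(1) by (auto simp: complete_digraph_def E_def)
      thus False
        using assms(3) by simp
    next
      case False
      hence "1 \<le> card W"
        using finW by (simp add: Suc_le_eq card_gt_0_iff)
      moreover have "complete_bipartite_digraph 1 (card W) G"
      proof -
        have "{x} \<inter> W = {}" "card {x} = 1"
          by (auto simp: W_def)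
        thus ?thesis
          using assms(1) V E unfolding complete_bipartite_digraph_def E_def by blast
      qed
      ultimately show False
        using assms(4) le by simp
    qed
  qed
  have "verts G \<noteq> {}"
    using assms(2) by (auto simp: connected_def strongly_connected_def)
  then obtain a b where ab: "(a, b) \<in> E"
    using no_star by blast
  show ?thesis
  \<comment> \<open>Two disjoint edges force the path on four vertices; otherwise the edges form a
    triangle.\<close>
  proof (cases "\<exists>a b c d. (a, b) \<in> E \<and> (c, d) \<in> E \<and> {a, b} \<inter> {c, d} = {}")
    case True
    have path: ?thesis
      if e: "(a, b) \<in> E" "(c, d) \<in> E" "(b, c) \<in> E" and disj: "{a, b} \<inter> {c, d} = {}" for a b c d
    proof -
      have dist: "distinct [a, b, c, d]"
        using disj e irr by auto
      have E: "E = {(a, b), (b, a), (b, c), (c, b), (c, d), (d, c)}"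
      proof (rule E_eq)
        show "{(a, b), (b, a), (b, c), (c, b), (c, d), (d, c)} \<subseteq> E"
          using e sym by simp
      qed (use dist in \<open>auto intro: symI\<close>)
      have "verts G \<subseteq> {a, b, c, d}"
        using leave[of a "{a, b, c, d}"] Ev(1)[OF e(1)] by (auto simp: E)
      hence V: "verts G = {a, b, c, d}"
        using Ev[OF e(1)] Ev[OF e(2)] by auto
      show ?thesis
        using graph_energy_path4[OF assms(1) V dist] E by (simp add: E_def)
    qed
    obtain a b c d where e: "(a, b) \<in> E" "(c, d) \<in> E" and disj: "{a, b} \<inter> {c, d} = {}"
      using True by blast
    obtain p x where px: "p \<in> {a, b}" "x \<notin> {a, b}" "(p, x) \<in> E"
      using leave[of a "{a, b}" c] Ev[OF e(1)] Ev[OF e(2)] disj by auto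
    \<comment> \<open>Otherwise the third edge \<open>(p, x)\<close> misses \<open>{c, d}\<close>,
      and no edge is left to leave that set.\<close>
    have x: "x \<in> {c, d}"
    proof (rule ccontr)
      assume x: "x \<notin> {c, d}"
      have ne: "a \<noteq> b" "c \<noteq> d"
        using e irr by auto
      have E: "E = {(a, b), (b, a), (c, d), (d, c), (p, x), (x, p)}"
      proof (rule E_eq)
        show "{(a, b), (b, a), (c, d), (d, c), (p, x), (x, p)} \<subseteq> E"
          using e px sym by simp
        show "card {(a, b), (b, a), (c, d), (d, c), (p, x), (x, p)} = 6"
          using ne px(1,2) x disj by auto
      qed (auto intro: symI)
      obtain u v where "u \<in> {c, d}" "v \<notin> {c, d}" "(u, v) \<in> E"
        using leave[of c "{c, d}" a] Ev(1)[OF e(1)] Ev(1)[OF e(2)] disj by auto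
      thus False
        using px(1) x disj by (auto simp: E)
    qed
    \<comment> \<open>Both edges are oriented so that \<open>p'\<close>, \<open>p\<close>,
      \<open>x\<close>, \<open>x'\<close> is a path.\<close>
    obtain p' where p': "(p', p) \<in> E" "{p', p} = {a, b}"
      using px(1) e(1) sym[OF e(1)] by auto
    obtain x' where x': "(x, x') \<in> E" "{x, x'} = {c, d}"
      using x e(2) sym[OF e(2)] by auto
    show ?thesis
      using path[OF p'(1) x'(1) px(3)] disj unfolding p'(2) x'(2) by simp
  next
    case False
    hence meet: "{u, v} \<inter> {w, z} \<noteq> {}" if "(u, v) \<in> E" "(w, z) \<in> E" for u v w z
      using that by blast
    obtain u v where uv: "(u, v) \<in> E" "u \<noteq> a" "v \<noteq> a"
      using no_star[OF Ev(1)[OF ab]] by blast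
    \<comment> \<open>An edge avoiding \<open>a\<close> must meet \<open>{a, b}\<close> in
      \<open>b\<close>.\<close>
    obtain c where bc: "(b, c) \<in> E" "c \<noteq> a"
      using meet[OF ab uv(1)] uv sym[OF uv(1)] by auto
    obtain w z where wz: "(w, z) \<in> E" "w \<noteq> b" "z \<noteq> b"
      using no_star[OF Ev(2)[OF ab]] by blast
    \<comment> \<open>An edge avoiding \<open>b\<close> must meet \<open>{a, b}\<close> in
      \<open>a\<close> and \<open>{b, c}\<close> in \<open>c\<close>.\<close>
    have ac: "(a, c) \<in> E"
      using meet[OF ab wz(1)] meet[OF bc(1) wz(1)] wz sym[OF wz(1)] bc(2) by auto
    have dist: "a \<noteq> b" "b \<noteq> c" "a \<noteq> c"
      using ab bc irr by auto
    have E: "E = {(a, b), (b, a), (b, c), (c, b), (a, c), (c, a)}"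
    proof (rule E_eq)
      show "{(a, b), (b, a), (b, c), (c, b), (a, c), (c, a)} \<subseteq> E"
        using ab bc ac sym by simp
    qed (use dist in \<open>auto intro: symI\<close>)
    have "verts G \<subseteq> {a, b, c}"
      using leave[of a "{a, b, c}"] Ev(1)[OF ab] by (auto simp: E)
    hence V: "verts G = {a, b, c}"
      using Ev[OF ab] Ev[OF bc(1)] by auto
    show ?thesis
      using graph_energy_triangle[OF assms(1) V dist] E by (simp add: E_def)
  qed
qed

end
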